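(* Let $a,b$ be nonzero real numbers and let $k$ be a positive even integer. Then for every real $x$ with $(ax)^2\ge-4b$, \[ \sqrt[k]{\tfrac{\psi^{a,b}_{k}(x)}{2}+\sqrt{\tfrac{(\psi^{a,b}_{k}(x))^2}{4}-b^k}}-\sqrt[k]{\tfrac{\psi^{a,b}_{k}(x)}{2}-\sqrt{\tfrac{(\psi^{a,b}_{k}(x))^2}{4}-b^k}}=\begin{cases}|ax|,& b>0,\\ \sqrt{a^2x^2+4b},& b<0,\end{cases} \] and \[ \sqrt[k]{\tfrac{\psi^{a,b}_{k}(x)}{2}+\sqrt{\tfrac{(\psi^{a,b}_{k}(x))^2}{4}-b^k}}+\sqrt[k]{\tfrac{\psi^{a,b}_{k}(x)}{2}-\sqrt{\tfrac{(\psi^{a,b}_{k}(x))^2}{4}-b^k}}=\begin{cases}\sqrt{a^2x^2+4b},& b>0,\\ |ax|,& b<0.\end{cases} \]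
   Context: The generalized Lucas polynomials are defined by $\psi^{a,b}_0(x)=2$, $\psi^{a,b}_1(x)=ax$, $\psi^{a,b}_j(x)=ax\,\psi^{a,b}_{j-1}(x)+b\,\psi^{a,b}_{j-2}(x)$ for $j\ge2$. $\sqrt{\cdot}$ denotes the nonnegative square root and, for even $k$, $\sqrt[k]{\cdot}$ the nonnegative $k$-th root of a nonnegative real. *)

theory Defs
  imports Complex_Main "HOL-Computational_Algebra.Polynomial"
begin

fun gen_lucas :: "real \<Rightarrow> real \<Rightarrow> nat \<Rightarrow> real poly" where
  "gen_lucas a b 0 = [:2:]"
| "gen_lucas a b (Suc 0) = [:0, a:]"
| "gen_lucas a b (Suc (Suc j)) = [:0, a:] * gen_lucas a b (Suc j) + smult b (gen_lucas a b j)"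

end

theory Submission imports Defs begin

text \<open>With \<open>u, v\<close> the roots of \<open>y\<^sup>2 = a x y + b\<close>, the Lucas polynomial evaluates to \<open>u ^ k + v ^ k\<close>, and
  \<open>(u v) ^ k = b ^ k\<close> for even \<open>k\<close>. So the two radicands are \<open>u ^ k\<close> and \<open>v ^ k\<close>, and their
  \<open>k\<close>-th roots are the larger and the smaller of \<open>\<bar>u\<bar>, \<bar>v\<bar>\<close>. The sign of \<open>b\<close> decides whether
  \<open>u\<close> and \<open>v\<close> have the same sign.\<close>

text \<open>The two hypotheses are Vieta's relations, so the sequences \<open>u ^ n\<close> and
  \<open>v ^ n\<close> each satisfy the Lucas recurrence, and their sum has the initial values
  \<open>2\<close> and \<open>a * x\<close>.\<close>

lemma poly_gen_lucas_eq_power_sum: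
  fixes u v :: real
  assumes "u + v = a * x" and "u * v = - b"
  shows "poly (gen_lucas a b n) x = u ^ n + v ^ n"
proof (induction n rule: induct_nat_012)
  case (ge2 j)
  have "poly (gen_lucas a b (Suc (Suc j))) x
      = (u + v) * (u ^ Suc j + v ^ Suc j) - u * v * (u ^ j + v ^ j)"
    using ge2 assms by (simp add: mult.commute)
  also have "\<dots> = u ^ Suc (Suc j) + v ^ Suc (Suc j)"
    by (simp add: algebra_simps)
  finally show ?case .
qed (use assms in \<open>auto simp: mult.commute\<close>)

text \<open>The quantity under the square root is the perfect square of
  \<open>(p ^ k - q ^ k) / 2\<close>; the order of \<open>p\<close> and \<open>q\<close> fixes the
  sign of its root.\<close>

lemma radicals_of_power_sum:
  fixes p q c s :: real
  assumes "0 \<le> q" and "q \<le> p" and "s = p ^ k + q ^ k" and "c = (p * q) ^ k"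
  shows "s\<^sup>2 / 4 - c \<ge> 0"
    and "s / 2 + sqrt (s\<^sup>2 / 4 - c) = p ^ k"
    and "s / 2 - sqrt (s\<^sup>2 / 4 - c) = q ^ k"
proof -
  have D: "s\<^sup>2 / 4 - c = ((p ^ k - q ^ k) / 2)\<^sup>2"
    by (simp add: assms(3,4) power_mult_distrib power2_eq_square field_simps)
  moreover have "q ^ k \<le> p ^ k"
    using assms by (intro power_mono)
  ultimately have "sqrt (s\<^sup>2 / 4 - c) = (p ^ k - q ^ k) / 2"
    by simp
  then show "s / 2 + sqrt (s\<^sup>2 / 4 - c) = p ^ k" "s / 2 - sqrt (s\<^sup>2 / 4 - c) = q ^ k"
    using assms(3) by (simp_all add: field_simps)
  show "s\<^sup>2 / 4 - c \<ge> 0"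
    unfolding D by simp
qed

theorem theorem6:
  fixes a b x :: real and k :: nat
  assumes "a \<noteq> 0" and "b \<noteq> 0"
    and "k > 0" and "even k"
    and "(a * x)\<^sup>2 \<ge> - 4 * b"
  shows "let \<psi> = poly (gen_lucas a b k) x;
             D = \<psi>\<^sup>2 / 4 - b ^ k;
             P = \<psi> / 2 + sqrt D;
             M = \<psi> / 2 - sqrt D
         in D \<ge> 0 \<and> P \<ge> 0 \<and> M \<ge> 0 \<and>
            root k P - root k M = (if b > 0 then \<bar>a * x\<bar> else sqrt (a\<^sup>2 * x\<^sup>2 + 4 * b)) \<and>
            root k P + root k M = (if b > 0 then sqrt (a\<^sup>2 * x\<^sup>2 + 4 * b) else \<bar>a * x\<bar>)"
proof -
  define t where "t = a * x"
  define s where "s = sqrt (a\<^sup>2 * x\<^sup>2 + 4 * b)"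
  define u where "u = (t + s) / 2"
  define v where "v = (t - s) / 2"
  \<comment> \<open>Either of \<open>u\<close>, \<open>v\<close> may be negative or dominate in
    absolute value; sorting the absolute values gives \<open>0 \<le> q \<le> p\<close>, and even
    powers do not see the change.\<close>
  define p where "p = max \<bar>u\<bar> \<bar>v\<bar>"
  define q where "q = min \<bar>u\<bar> \<bar>v\<bar>"
  have s: "s \<ge> 0" "s\<^sup>2 = t\<^sup>2 + 4 * b"
    using assms(5) by (auto simp: s_def t_def power_mult_distrib)
  have uv: "u + v = t" "u * v = - b"
    using s by (auto simp: u_def v_def field_simps power2_eq_square)
  have pq: "p * q = \<bar>b\<bar>"
    using uv(2) by (metis abs_minus abs_mult max_def min_def mult.commute p_def q_def)
  have "poly (gen_lucas a b k) x = u ^ k + v ^ k"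
    using uv by (intro poly_gen_lucas_eq_power_sum) (auto simp: t_def)
  also have "\<dots> = \<bar>u\<bar> ^ k + \<bar>v\<bar> ^ k"
    using \<open>even k\<close> by (simp add: power_even_abs)
  also have "\<dots> = p ^ k + q ^ k"
    by (auto simp: p_def q_def max_def min_def)
  finally have psi: "poly (gen_lucas a b k) x = p ^ k + q ^ k" .
  have bk: "b ^ k = (p * q) ^ k"
    using \<open>even k\<close> by (simp add: pq power_even_abs)
  have q0: "0 \<le> q" "q \<le> p"
    by (auto simp: p_def q_def)
  have roots: "root k (p ^ k) = p" "root k (q ^ k) = q"
    using q0 \<open>k > 0\<close> by (auto intro!: real_root_power_cancel)
  \<comment> \<open>Since \<open>u\<close> and \<open>v\<close> are the half sum and half difference
    of \<open>t\<close> and \<open>s\<close>, \<open>p + q\<close> is the larger and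
    \<open>p - q\<close> the smaller of \<open>\<bar>t\<bar>\<close> and \<open>s\<close>. Which is
    which follows from \<open>s\<^sup>2 - t\<^sup>2 = 4 * b\<close>.\<close>
  have "p - q = (if b > 0 then \<bar>t\<bar> else s) \<and> p + q = (if b > 0 then s else \<bar>t\<bar>)"
  proof (cases "b > 0")
    case True
    then have "\<bar>t\<bar> \<le> \<bar>s\<bar>"
      using s(2) unfolding abs_le_square_iff by simp
    then show ?thesis
      using True s(1) unfolding p_def q_def u_def v_def by (auto simp: abs_if max_def min_def field_simps)
  next
    case False
    then have "\<bar>s\<bar> \<le> \<bar>t\<bar>"
      using s(2) unfolding abs_le_square_iff by simp
    then show ?thesis
      using False s(1) unfolding p_def q_def u_def v_def by (auto simp: abs_if max_def min_def field_simps)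
  qed
  then show ?thesis
    using radicals_of_power_sum[OF q0 psi bk] q0 roots
    unfolding Let_def t_def s_def by simp
qed

end
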